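(* Let $(X,d)$ be a geodesic metric space. Then the following conditions are equivalent: (i) $(X,d)$ is polygon hyperbolic; (ii) there exists some $\delta' \geq 0$ such that $$(x_0|x_n)_p \geq \min\{ (x_0|x_1)_p, (x_1|x_2)_p, \ldots, (x_{n-1}|x_n)_p \} - \delta'$$ holds for all $n \geq 2$ and all $x_0,\ldots,x_n,p \in X$; (iii) there exists some $\varepsilon \geq 0$ such that, for every geodesic $\xi$ in $(X,d)$ and every path $\xi'$ in $(X,d)$ coterminal with $\xi$, $$\mathrm{Im}(\xi) \subseteq D_{\varepsilon}(\mathrm{Im}(\xi'));$$ (iv) $\mathrm{mesh}(X,d) < +\infty$.
   Context: Let $(X,d)$ be a metric space. For $x \in X$ and $\varepsilon \geq 0$, $D_\varepsilon(x)$ is the closed ball of center $x$ and radius $\varepsilon$; for nonempty $Y \subseteq X$, $D_\varepsilon(Y) = \bigcup_{y\in Y} D_\varepsilon(y)$. Maps are written on the right of their arguments ($t\xi$ is the image of $t$ under $\xi$). A path in $(X,d)$ is a continuous map $\xi:[0,s]\to X$ with $s \in \mathbb{R}$, $s \geq 0$; $\mathrm{Im}(\xi)$ is its image. Two paths $\xi:[0,s]\to X$ and $\xi':[0,s']\to X$ are coterminal if $0\xi = 0\xi'$ and $s\xi = s'\xi'$. A geodesic is a path $\xi:[0,s]\to X$ that is an isometric embedding, i.e. $d(t\xi,t'\xi)=|t-t'|$ for all $t,t'\in[0,s]$. $(X,d)$ is a geodesic metric space if for all $x,y\in X$ there is a geodesic $\xi:[0,s]\to X$ with $0\xi=x$,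 $s\xi=y$. A geodesic polygon is a collection $[[\xi_0,\xi_1,\ldots,\xi_n]]$ ($n\geq 1$ arbitrary) of geodesics $\xi_i:[0,s_i]\to X$ such that $s_i\xi_i = 0\xi_{i+1}$ for $i=0,\ldots,n$, indices taken modulo $n+1$. For $\delta\geq 0$, it is $\delta$-thin if $$\mathrm{Im}(\xi_n)\subseteq D_\delta(\mathrm{Im}(\xi_0)\cup\cdots\cup\mathrm{Im}(\xi_{n-1})).$$ A geodesic metric space is polygon $\delta$-hyperbolic if every geodesic polygon in it is $\delta$-thin (same $\delta$ for all $n$), and polygon hyperbolic if it is polygon $\delta$-hyperbolic for some $\delta\geq 0$. For $x,y,p\in X$, the Gromov product is $(x|y)_p=\frac12(d(p,x)+d(p,y)-d(x,y))$. A triangle in $(X,d)$ is a collection $\Delta=[[\xi_0,\xi_1,\xi_2]]$ of three (arbitrary) paths $\xi_i:[0,s_i]\to X$ with $s_i\xi_i=0\xi_{i+1}$ for $i=0,1,2$, indices modulo $3$. Its mesh is $\mathrm{mesh}(\Delta)=\inf\{\mathrm{diam}(\{u_0,u_1,u_2\}) \mid u_i\in\mathrm{Im}(\xi_i),\ i=0,1,2\}$, and $\mathrm{mesh}(X,d)=\sup\{\mathrm{mesh}(\Delta)\mid \Delta \text{ is a triangle in }(X,d)\}$. *)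

theory Defs
  imports "HOL-Analysis.Analysis"
begin

text \<open>
  The metric space is a set \<open>X :: 'a::metric_space set\<close> with the restricted metric, so the empty
  space is included. A map with domain \<open>[0,s]\<close> is represented by the pair \<open>(s, f)\<close>, where the values
  of \<open>f\<close> outside \<open>{0..s}\<close> are never used.
\<close>

type_synonym 'a curve = "real \<times> (real \<Rightarrow> 'a)"

definition curve_start :: "'a curve \<Rightarrow> 'a" where
  "curve_start \<xi> = snd \<xi> 0"

definition curve_end :: "'a curve \<Rightarrow> 'a" where
  "curve_end \<xi> = snd \<xi> (fst \<xi>)"

definition curve_image :: "'a curve \<Rightarrow> 'a set" where
  "curve_image \<xi> = snd \<xi> ` {0..fst \<xi>}"

definition path_in_space :: "'a::metric_space set \<Rightarrow> 'a curve \<Rightarrow> bool" where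
  "path_in_space X \<xi> \<longleftrightarrow>
     0 \<le> fst \<xi> \<and> continuous_on {0..fst \<xi>} (snd \<xi>) \<and> curve_image \<xi> \<subseteq> X"

definition coterminal :: "'a curve \<Rightarrow> 'a curve \<Rightarrow> bool" where
  "coterminal \<xi> \<xi>' \<longleftrightarrow> curve_start \<xi> = curve_start \<xi>' \<and> curve_end \<xi> = curve_end \<xi>'"

definition geodesic :: "'a::metric_space set \<Rightarrow> 'a curve \<Rightarrow> bool" where
  "geodesic X \<xi> \<longleftrightarrow> path_in_space X \<xi> \<and>
     (\<forall>t\<in>{0..fst \<xi>}. \<forall>t'\<in>{0..fst \<xi>}. dist (snd \<xi> t) (snd \<xi> t') = \<bar>t - t'\<bar>)"

definition geodesic_space :: "'a::metric_space set \<Rightarrow> bool" where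
  "geodesic_space X \<longleftrightarrow>
     (\<forall>x\<in>X. \<forall>y\<in>X. \<exists>\<xi>. geodesic X \<xi> \<and> curve_start \<xi> = x \<and> curve_end \<xi> = y)"

definition closed_nbhd :: "'a::metric_space set \<Rightarrow> real \<Rightarrow> 'a set \<Rightarrow> 'a set" where
  "closed_nbhd X \<epsilon> Y = (\<Union>y\<in>Y. cball y \<epsilon> \<inter> X)"

text \<open>Cyclic concatenability of the \<open>n + 1\<close> curves \<open>\<xi> 0, \<dots>, \<xi> n\<close>.\<close>

definition cyclically_joined :: "nat \<Rightarrow> (nat \<Rightarrow> 'a curve) \<Rightarrow> bool" where
  "cyclically_joined n \<xi> \<longleftrightarrow>
     (\<forall>i\<le>n. curve_end (\<xi> i) = curve_start (\<xi> ((i + 1) mod (n + 1))))"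

definition geodesic_polygon :: "'a::metric_space set \<Rightarrow> nat \<Rightarrow> (nat \<Rightarrow> 'a curve) \<Rightarrow> bool" where
  "geodesic_polygon X n \<xi> \<longleftrightarrow>
     n \<ge> 1 \<and> (\<forall>i\<le>n. geodesic X (\<xi> i)) \<and> cyclically_joined n \<xi>"

definition thin_polygon ::
  "'a::metric_space set \<Rightarrow> real \<Rightarrow> nat \<Rightarrow> (nat \<Rightarrow> 'a curve) \<Rightarrow> bool" where
  "thin_polygon X \<delta> n \<xi> \<longleftrightarrow>
     curve_image (\<xi> n) \<subseteq> closed_nbhd X \<delta> (\<Union>i<n. curve_image (\<xi> i))"

definition polygon_delta_hyperbolic :: "'a::metric_space set \<Rightarrow> real \<Rightarrow> bool" where
  "polygon_delta_hyperbolic X \<delta> \<longleftrightarrow>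
     (\<forall>n \<xi>. geodesic_polygon X n \<xi> \<longrightarrow> thin_polygon X \<delta> n \<xi>)"

definition polygon_hyperbolic :: "'a::metric_space set \<Rightarrow> bool" where
  "polygon_hyperbolic X \<longleftrightarrow> (\<exists>\<delta>\<ge>0. polygon_delta_hyperbolic X \<delta>)"

definition gromov_product :: "'a::metric_space \<Rightarrow> 'a \<Rightarrow> 'a \<Rightarrow> real" where
  "gromov_product p x y = (dist p x + dist p y - dist x y) / 2"

text \<open>The sides of a triangle are arbitrary paths, not necessarily geodesics.\<close>

definition path_triangle :: "'a::metric_space set \<Rightarrow> (nat \<Rightarrow> 'a curve) \<Rightarrow> bool" where
  "path_triangle X \<xi> \<longleftrightarrow> (\<forall>i\<le>2. path_in_space X (\<xi> i)) \<and> cyclically_joined 2 \<xi>"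

definition triangle_mesh :: "(nat \<Rightarrow> 'a::metric_space curve) \<Rightarrow> real" where
  "triangle_mesh \<xi> = Inf {diameter {u0, u1, u2} | u0 u1 u2.
     u0 \<in> curve_image (\<xi> 0) \<and> u1 \<in> curve_image (\<xi> 1) \<and> u2 \<in> curve_image (\<xi> 2)}"

text \<open>The supremum may be infinite, hence the type \<^typ>\<open>ereal\<close>.\<close>

definition space_mesh :: "'a::metric_space set \<Rightarrow> ereal" where
  "space_mesh X = (SUP \<xi> \<in> {\<xi>. path_triangle X \<xi>}. ereal (triangle_mesh \<xi>))"

end

theory Submission
  imports Defs
begin

text \<open>
  Finely subdividing a path turns it into a chain of points with small steps, to which polygon
  thinness (after joining consecutive points by geodesics) and the inequality for Gromov products
  both apply; conversely the concatenation of all sides of a polygon but one is a path. This relates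
  (i) and (ii) to the stability condition (iii). By connectedness, stability yields a point of a
  geodesic which is close to both of the other two sides of any triangle on it: this gives (ii), as
  the distance from \<open>p\<close> to a geodesic from \<open>x\<close> to \<open>y\<close> is then \<open>(x|y)\<^sub>p\<close> up to a constant, and (iv).
  Finally, a point \<open>p\<close> of a geodesic cuts it into two sides of a triangle whose third side is the
  given coterminal path; three points on these sides at mutual distance at most \<open>M\<close> force \<open>p\<close> to be
  \<open>2 M\<close>-close to the path, as \<open>p\<close> lies between the two points on the geodesic.
\<close>

section \<open>Operations on curves\<close>

definition curve_reverse :: "'a curve \<Rightarrow> 'a curve" where
  "curve_reverse \<xi> = (fst \<xi>, \<lambda>t. snd \<xi> (fst \<xi> - t))"

definition curve_join :: "'a curve \<Rightarrow> 'a curve \<Rightarrow> 'a curve" where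
  "curve_join \<xi> \<eta> = (fst \<xi> + fst \<eta>, \<lambda>t. if t \<le> fst \<xi> then snd \<xi> t else snd \<eta> (t - fst \<xi>))"

definition curve_part :: "'a curve \<Rightarrow> real \<Rightarrow> real \<Rightarrow> 'a curve" where
  "curve_part \<xi> a b = (b - a, \<lambda>t. snd \<xi> (a + t))"

lemma geodesic_imp_path: "geodesic X \<xi> \<Longrightarrow> path_in_space X \<xi>"
  by (simp add: geodesic_def)

lemma curve_start_in_image: "path_in_space X \<xi> \<Longrightarrow> curve_start \<xi> \<in> curve_image \<xi>"
  by (auto simp: path_in_space_def curve_start_def curve_image_def)

lemma curve_end_in_image: "path_in_space X \<xi> \<Longrightarrow> curve_end \<xi> \<in> curve_image \<xi>"
  by (auto simp: path_in_space_def curve_end_def curve_image_def)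

lemma curve_image_subset: "path_in_space X \<xi> \<Longrightarrow> curve_image \<xi> \<subseteq> X"
  by (simp add: path_in_space_def)

lemma curve_start_reverse [simp]: "curve_start (curve_reverse \<xi>) = curve_end \<xi>"
  by (simp add: curve_reverse_def curve_start_def curve_end_def)

lemma curve_end_reverse [simp]: "curve_end (curve_reverse \<xi>) = curve_start \<xi>"
  by (simp add: curve_reverse_def curve_start_def curve_end_def)

lemma curve_image_reverse [simp]: "curve_image (curve_reverse \<xi>) = curve_image \<xi>"
proof -
  have "(\<lambda>t. fst \<xi> - t) ` {0..fst \<xi>} = {0..fst \<xi>}"
    by simp
  then show ?thesis
    unfolding curve_image_def curve_reverse_def
    by (metis (no_types, lifting) fst_conv image_cong image_image snd_conv)
qed

lemma path_in_space_reverse: "path_in_space X (curve_reverse \<xi>)" if "path_in_space X \<xi>"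
proof -
  have "continuous_on {0..fst \<xi>} (\<lambda>t. snd \<xi> (fst \<xi> - t))"
    by (rule continuous_on_compose2[where t = "{0..fst \<xi>}"])
      (use that in \<open>auto simp: path_in_space_def intro!: continuous_intros\<close>)
  then show ?thesis
    using that curve_image_reverse[of \<xi>] by (auto simp: path_in_space_def curve_reverse_def)
qed

lemma geodesic_reverse: "geodesic X \<xi> \<Longrightarrow> geodesic X (curve_reverse \<xi>)"
  by (auto simp: geodesic_def path_in_space_reverse) (auto simp: curve_reverse_def)

lemma curve_start_join: "0 \<le> fst \<xi> \<Longrightarrow> curve_start (curve_join \<xi> \<eta>) = curve_start \<xi>"
  by (simp add: curve_join_def curve_start_def)

lemma curve_end_join:
  "0 \<le> fst \<eta> \<Longrightarrow> curve_end \<xi> = curve_start \<eta> \<Longrightarrow> curve_end (curve_join \<xi> \<eta>) = curve_end \<eta>"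
  by (simp add: curve_join_def curve_start_def curve_end_def)

lemma curve_image_join:
  assumes "path_in_space X \<xi>" "path_in_space X \<eta>" "curve_end \<xi> = curve_start \<eta>"
  shows "curve_image (curve_join \<xi> \<eta>) = curve_image \<xi> \<union> curve_image \<eta>"
proof (intro equalityI subsetI)
  fix z assume "z \<in> curve_image (curve_join \<xi> \<eta>)"
  then show "z \<in> curve_image \<xi> \<union> curve_image \<eta>"
    by (auto simp: curve_image_def curve_join_def split: if_splits)
next
  fix z assume "z \<in> curve_image \<xi> \<union> curve_image \<eta>"
  then consider t where "t \<in> {0..fst \<xi>}" "z = snd \<xi> t" | t where "t \<in> {0..fst \<eta>}" "z = snd \<eta> t"
    by (auto simp: curve_image_def)
  then show "z \<in> curve_image (curve_join \<xi> \<eta>)"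
  proof cases
    case 1
    then show ?thesis
      using assms by (auto simp: curve_image_def curve_join_def path_in_space_def
          intro!: rev_image_eqI[of t])
  next
    case 2
    then show ?thesis
      using assms by (auto simp: curve_image_def curve_join_def path_in_space_def
          curve_end_def curve_start_def intro!: rev_image_eqI[of "fst \<xi> + t"])
  qed
qed

lemma path_in_space_join:
  assumes "path_in_space X \<xi>" "path_in_space X \<eta>" "curve_end \<xi> = curve_start \<eta>"
  shows "path_in_space X (curve_join \<xi> \<eta>)"
proof -
  have 0: "0 \<le> fst \<xi>" "0 \<le> fst \<eta>"
    using assms by (auto simp: path_in_space_def)
  have "continuous_on {fst \<xi>..fst \<xi> + fst \<eta>} (\<lambda>t. snd \<eta> (t - fst \<xi>))"
    by (rule continuous_on_compose2[where t = "{0..fst \<eta>}"])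
      (use assms in \<open>auto simp: path_in_space_def intro!: continuous_intros\<close>)
  then have "continuous_on ({0..fst \<xi>} \<union> {fst \<xi>..fst \<xi> + fst \<eta>})
      (\<lambda>t. if t \<le> fst \<xi> then snd \<xi> t else snd \<eta> (t - fst \<xi>))"
    using assms by (intro continuous_on_cases)
      (auto simp: path_in_space_def curve_end_def curve_start_def)
  moreover have "{0..fst \<xi>} \<union> {fst \<xi>..fst \<xi> + fst \<eta>} = {0..fst \<xi> + fst \<eta>}"
    using 0 by auto
  ultimately have "continuous_on {0..fst (curve_join \<xi> \<eta>)} (snd (curve_join \<xi> \<eta>))"
    by (simp add: curve_join_def)
  moreover have "curve_image (curve_join \<xi> \<eta>) \<subseteq> X"
    using curve_image_join[OF assms] assms by (simp add: path_in_space_def)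
  ultimately show ?thesis
    using 0 by (auto simp: path_in_space_def curve_join_def)
qed

lemma curve_start_part: "curve_start (curve_part \<xi> a b) = snd \<xi> a"
  by (simp add: curve_part_def curve_start_def)

lemma curve_end_part: "curve_end (curve_part \<xi> a b) = snd \<xi> b"
  by (simp add: curve_part_def curve_end_def)

lemma curve_image_part: "curve_image (curve_part \<xi> a b) = snd \<xi> ` {a..b}"
proof -
  have "(\<lambda>t. a + t) ` {0..b - a} = {a..b}"
    by simp
  then show ?thesis
    unfolding curve_image_def curve_part_def
    by (metis (no_types, lifting) fst_conv image_cong image_image snd_conv)
qed

lemma path_in_space_part:
  assumes "path_in_space X \<xi>" "0 \<le> a" "a \<le> b" "b \<le> fst \<xi>"
  shows "path_in_space X (curve_part \<xi> a b)"
proof -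
  have "continuous_on {0..b - a} (\<lambda>t. snd \<xi> (a + t))"
    by (rule continuous_on_compose2[where t = "{0..fst \<xi>}"])
      (use assms in \<open>auto simp: path_in_space_def intro!: continuous_intros\<close>)
  moreover have "curve_image (curve_part \<xi> a b) \<subseteq> X"
    using assms unfolding curve_image_part by (auto simp: path_in_space_def curve_image_def)
  ultimately show ?thesis
    using assms by (auto simp: path_in_space_def curve_part_def)
qed

text \<open>Uniform continuity on the compact parameter interval makes equal time steps move the
  point by at most 1. The value 1 is an arbitrary fixed scale; it reappears as the additive 1 in the
  later constants.\<close>

lemma path_subdivision:
  assumes "path_in_space X \<xi>"
  obtains n :: nat and x where "n \<ge> 2" "x 0 = curve_start \<xi>" "x n = curve_end \<xi>"
    "\<And>i. i \<le> n \<Longrightarrow> x i \<in> curve_image \<xi>" "\<And>i. i < n \<Longrightarrow> dist (x i) (x (i + 1)) \<le> 1"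
proof -
  define s where "s = fst \<xi>"
  have s: "0 \<le> s" and cont: "continuous_on {0..s} (snd \<xi>)"
    using assms by (auto simp: path_in_space_def s_def)
  have "uniformly_continuous_on {0..s} (snd \<xi>)"
    by (rule compact_uniformly_continuous[OF cont]) simp
  then obtain d where d: "d > 0"
    "\<And>t t'. \<lbrakk>t \<in> {0..s}; t' \<in> {0..s}; dist t' t < d\<rbrakk> \<Longrightarrow> dist (snd \<xi> t') (snd \<xi> t) < 1"
    unfolding uniformly_continuous_on_def by (metis zero_less_one)
  obtain m :: nat where m: "s / d < real m"
    using reals_Archimedean2 by blast
  \<comment> \<open>The summand 2 secures \<open>n \<ge> 2\<close>, as the Gromov product inequality
    demands; since \<open>n > m\<close>, the time step \<open>s / n\<close> is still below
    \<open>d\<close>.\<close>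
  define n where "n = m + 2"
  have n: "s / real n < d" "n \<ge> 2"
    using m d(1) s by (auto simp: n_def field_simps add_strict_increasing2)
  define x where "x i = snd \<xi> (s * (real i / real n))" for i
  have rng: "s * (real i / real n) \<in> {0..s}" if "i \<le> n" for i
    using that s n(2) mult_left_le[of "real i / real n" s] by auto
  show thesis
  proof (rule that[of n x])
    show "x 0 = curve_start \<xi>" "x n = curve_end \<xi>"
      using n(2) by (auto simp: x_def curve_start_def curve_end_def s_def)
    show "x i \<in> curve_image \<xi>" if "i \<le> n" for i
      using rng[OF that] by (auto simp: x_def curve_image_def s_def)
    show "dist (x i) (x (i + 1)) \<le> 1" if "i < n" for i
    proof -
      have "s * (real (i + 1) / real n) - s * (real i / real n) = s / real n"
        by (simp add: algebra_simps add_divide_distrib)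
      then have "dist (s * (real i / real n)) (s * (real (i + 1) / real n)) < d"
        using n(1) divide_nonneg_nonneg[OF s, of "real n"] unfolding dist_real_def by linarith
      with rng[of i] rng[of "i + 1"] that show ?thesis
        unfolding x_def by (intro less_imp_le d(2)) auto
    qed
  qed (use n in auto)
qed

text \<open>Iterated \<open>curve_join\<close>; it turns the sides of a polygon other than the last
  into a single path, to which stability applies.\<close>

lemma path_chain:
  fixes n :: nat
  assumes "\<And>i. i \<le> n \<Longrightarrow> path_in_space X (\<xi> i)"
    "\<And>i. i < n \<Longrightarrow> curve_end (\<xi> i) = curve_start (\<xi> (i + 1))"
  obtains \<eta> where "path_in_space X \<eta>" "curve_start \<eta> = curve_start (\<xi> 0)"
    "curve_end \<eta> = curve_end (\<xi> n)" "curve_image \<eta> = (\<Union>i\<le>n. curve_image (\<xi> i))"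
  using assms
proof (induction n arbitrary: thesis)
  case 0
  then show ?case by auto
next
  case (Suc n)
  obtain \<eta> where \<eta>: "path_in_space X \<eta>" "curve_start \<eta> = curve_start (\<xi> 0)"
    "curve_end \<eta> = curve_end (\<xi> n)" "curve_image \<eta> = (\<Union>i\<le>n. curve_image (\<xi> i))"
    using Suc.IH Suc.prems(2,3) by (metis le_SucI less_SucI)
  have last: "path_in_space X (\<xi> (Suc n))" "curve_end \<eta> = curve_start (\<xi> (Suc n))"
    using Suc.prems(2,3) \<eta>(3) by auto
  have "0 \<le> fst \<eta>" "0 \<le> fst (\<xi> (Suc n))"
    using \<eta>(1) last(1) by (auto simp: path_in_space_def)
  with \<eta> last show ?case
    by (intro Suc.prems(1)[of "curve_join \<eta> (\<xi> (Suc n))"])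
      (auto simp: path_in_space_join curve_start_join curve_end_join
        curve_image_join[OF \<eta>(1) last] atMost_Suc)
qed

section \<open>Distances along geodesics\<close>

lemma geodesic_dist_split:
  assumes "geodesic X \<xi>" "z \<in> curve_image \<xi>"
  shows "dist (curve_start \<xi>) z + dist z (curve_end \<xi>) = dist (curve_start \<xi>) (curve_end \<xi>)"
  using assms by (auto simp: geodesic_def path_in_space_def curve_image_def curve_start_def
      curve_end_def)

lemma gromov_product_on_geodesic:
  assumes "geodesic X \<xi>" "p \<in> curve_image \<xi>"
  shows "gromov_product p (curve_start \<xi>) (curve_end \<xi>) = 0"
  using geodesic_dist_split[OF assms] by (simp add: gromov_product_def dist_commute)

text \<open>Add the triangle inequalities from \<open>p\<close> to both ends through
  \<open>z\<close>: the two distances from \<open>z\<close> to the ends sum to the length of the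
  geodesic and cancel.\<close>

lemma gromov_product_le_dist_geodesic:
  assumes "geodesic X \<xi>" "z \<in> curve_image \<xi>"
  shows "gromov_product p (curve_start \<xi>) (curve_end \<xi>) \<le> dist p z"
  using geodesic_dist_split[OF assms] dist_triangle[of p "curve_start \<xi>" z]
    dist_triangle[of p "curve_end \<xi>" z]
  by (simp add: gromov_product_def dist_commute)

lemma gromov_product_commute: "gromov_product p x y = gromov_product p y x"
  by (simp add: gromov_product_def dist_commute)

lemma mem_closed_nbhd: "z \<in> closed_nbhd X \<epsilon> Y \<longleftrightarrow> z \<in> X \<and> (\<exists>y\<in>Y. dist z y \<le> \<epsilon>)"
  by (auto simp: closed_nbhd_def dist_commute)

section \<open>Stability of geodesics\<close>

text \<open>Condition (iii) for a fixed constant, in the very form of the goal. It is the hub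
  through which the equivalences are routed.\<close>

definition geodesics_stable :: "'a::metric_space set \<Rightarrow> real \<Rightarrow> bool" where
  "geodesics_stable X \<epsilon> \<longleftrightarrow>
     (\<forall>\<xi> \<xi>'. geodesic X \<xi> \<and> path_in_space X \<xi>' \<and> coterminal \<xi>' \<xi> \<longrightarrow>
        curve_image \<xi> \<subseteq> closed_nbhd X \<epsilon> (curve_image \<xi>'))"

lemma geodesics_stableI:
  assumes "\<And>\<xi> \<xi>' z. \<lbrakk>geodesic X \<xi>; path_in_space X \<xi>'; curve_start \<xi>' = curve_start \<xi>;
    curve_end \<xi>' = curve_end \<xi>; z \<in> curve_image \<xi>\<rbrakk> \<Longrightarrow> \<exists>w\<in>curve_image \<xi>'. dist z w \<le> \<epsilon>"
  shows "geodesics_stable X \<epsilon>"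
  unfolding geodesics_stable_def coterminal_def
proof (intro allI impI subsetI, elim conjE)
  fix \<xi> \<xi>' z
  assume "geodesic X \<xi>" "path_in_space X \<xi>'" "curve_start \<xi>' = curve_start \<xi>"
    "curve_end \<xi>' = curve_end \<xi>" "z \<in> curve_image \<xi>"
  then show "z \<in> closed_nbhd X \<epsilon> (curve_image \<xi>')"
    using assms curve_image_subset[OF geodesic_imp_path] unfolding mem_closed_nbhd by blast
qed

lemma geodesics_stableD:
  assumes "geodesics_stable X \<epsilon>" "geodesic X \<xi>" "path_in_space X \<xi>'"
    "curve_start \<xi>' = curve_start \<xi>" "curve_end \<xi>' = curve_end \<xi>" "z \<in> curve_image \<xi>"
  obtains w where "w \<in> curve_image \<xi>'" "dist z w \<le> \<epsilon>"
proof -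
  have "z \<in> closed_nbhd X \<epsilon> (curve_image \<xi>')"
    using assms unfolding geodesics_stable_def coterminal_def by blast
  then show thesis
    using that unfolding mem_closed_nbhd by blast
qed

lemma geodesics_stable_mono: "geodesics_stable X \<epsilon>'" if "geodesics_stable X \<epsilon>" "\<epsilon> \<le> \<epsilon>'"
proof -
  have "closed_nbhd X \<epsilon> Y \<subseteq> closed_nbhd X \<epsilon>' Y" for Y
    using that(2) unfolding mem_closed_nbhd subset_iff by (meson order_trans)
  with that(1) show ?thesis
    unfolding geodesics_stable_def by (meson order_trans)
qed

text \<open>Geodesics between consecutive points, closed up by \<open>\<xi>\<close>, form a polygon
  with \<open>n + 1\<close> sides. This is why \<open>\<xi>\<close> runs backwards, from
  \<open>x n\<close> to \<open>x 0\<close>.\<close>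

lemma polygon_hyperbolic_near_chain:
  fixes n :: nat
  assumes "geodesic_space X" "polygon_delta_hyperbolic X \<delta>" "n \<ge> 1" "\<And>i. i \<le> n \<Longrightarrow> x i \<in> X"
    "geodesic X \<xi>" "curve_start \<xi> = x n" "curve_end \<xi> = x 0" "z \<in> curve_image \<xi>"
  obtains i \<eta> w where "i < n" "geodesic X \<eta>" "curve_start \<eta> = x i" "curve_end \<eta> = x (i + 1)"
    "w \<in> curve_image \<eta>" "dist z w \<le> \<delta>"
proof -
  have "\<exists>\<eta>. geodesic X \<eta> \<and> curve_start \<eta> = x i \<and> curve_end \<eta> = x (i + 1)" if "i < n" for i
    using that assms(1) assms(4)[of i] assms(4)[of "i + 1"] by (auto simp: geodesic_space_def)
  then obtain g where g: "\<And>i. i < n \<Longrightarrow>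
      geodesic X (g i) \<and> curve_start (g i) = x i \<and> curve_end (g i) = x (i + 1)"
    by metis
  \<comment> \<open>Thinness singles out side \<open>n\<close>, so \<open>\<xi>\<close> has to take
    this index.\<close>
  define P where "P = g(n := \<xi>)"
  have "geodesic_polygon X n P"
    unfolding geodesic_polygon_def cyclically_joined_def
  proof (intro conjI allI impI)
    fix i assume "i \<le> n"
    \<comment> \<open>The index wraps around at \<open>i = n\<close>, and the next side is
      \<open>\<xi>\<close> when \<open>i + 1 = n\<close>; otherwise both sides come from
      \<open>g\<close>.\<close>
    then consider "i = n" | "i + 1 = n" | "i + 1 < n" by linarith
    then show "curve_end (P i) = curve_start (P ((i + 1) mod (n + 1)))"
      by cases (use assms g in \<open>auto simp: P_def\<close>)
  qed (use assms g in \<open>auto simp: P_def\<close>)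
  then have "thin_polygon X \<delta> n P"
    using assms(2) by (auto simp: polygon_delta_hyperbolic_def)
  then obtain i w where "i < n" "w \<in> curve_image (g i)" "dist z w \<le> \<delta>"
    using assms(8) by (auto simp: thin_polygon_def P_def mem_closed_nbhd subset_iff)
  then show thesis
    using that g by blast
qed

text \<open>Thinness puts \<open>z\<close> within \<open>\<delta>\<close> of a side joining two
  successive subdivision points; that side has length at most 1, so one of its ends, which lies on
  the path, is at most 1 further away.\<close>

lemma polygon_hyperbolic_imp_stable:
  assumes "geodesic_space X" "polygon_delta_hyperbolic X \<delta>"
  shows "geodesics_stable X (\<delta> + 1)"
proof (rule geodesics_stableI)
  fix \<xi> \<xi>' z
  assume \<xi>: "geodesic X \<xi>" and \<xi>': "path_in_space X \<xi>'"
    and ends: "curve_start \<xi>' = curve_start \<xi>" "curve_end \<xi>' = curve_end \<xi>"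
    and z: "z \<in> curve_image \<xi>"
  \<comment> \<open>The path is subdivided in reverse, so that \<open>\<xi>\<close> leads from
    \<open>x n\<close> back to \<open>x 0\<close> and closes the polygon.\<close>
  obtain n :: nat and x where x: "n \<ge> 2" "x 0 = curve_end \<xi>" "x n = curve_start \<xi>"
    "\<And>i. i \<le> n \<Longrightarrow> x i \<in> curve_image \<xi>'" "\<And>i. i < n \<Longrightarrow> dist (x i) (x (i + 1)) \<le> 1"
    using path_subdivision[OF path_in_space_reverse[OF \<xi>']] ends by auto
  have X: "x i \<in> X" if "i \<le> n" for i
    using x(4)[OF that] \<xi>' by (auto simp: path_in_space_def)
  from assms obtain i \<eta> w where \<eta>: "i < n" "geodesic X \<eta>" "curve_start \<eta> = x i"
    "curve_end \<eta> = x (i + 1)" "w \<in> curve_image \<eta>" "dist z w \<le> \<delta>"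
    by (rule polygon_hyperbolic_near_chain[of X \<delta> n x \<xi> z]) (use x X \<xi> z in auto)
  have "dist (x i) w + dist w (x (i + 1)) \<le> 1"
    using geodesic_dist_split[OF \<eta>(2,5)] \<eta>(1,3,4) x(5)[of i] by simp
  then have "dist w (x i) \<le> 1"
    using zero_le_dist[of w "x (i + 1)"] dist_commute[of w "x i"] by linarith
  then have "dist z (x i) \<le> \<delta> + 1"
    using \<eta>(6) dist_triangle[of z "x i" w] by linarith
  then show "\<exists>w\<in>curve_image \<xi>'. dist z w \<le> \<delta> + 1"
    using x(4)[of i] \<eta>(1) by auto
qed

lemma stable_imp_polygon_hyperbolic:
  assumes "geodesics_stable X \<epsilon>"
  shows "polygon_delta_hyperbolic X \<epsilon>"
  unfolding polygon_delta_hyperbolic_def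
proof (intro allI impI)
  fix n \<xi> assume P: "geodesic_polygon X n \<xi>"
  then obtain m where m: "n = Suc m"
    by (cases n) (auto simp: geodesic_polygon_def)
  have joined: "curve_end (\<xi> i) = curve_start (\<xi> ((i + 1) mod (n + 1)))" if "i \<le> n" for i
    using P that by (auto simp: geodesic_polygon_def cyclically_joined_def)
  have geo: "geodesic X (\<xi> i)" if "i \<le> n" for i
    using P that by (auto simp: geodesic_polygon_def)
  obtain \<eta> where \<eta>: "path_in_space X \<eta>" "curve_start \<eta> = curve_start (\<xi> 0)"
    "curve_end \<eta> = curve_end (\<xi> m)" "curve_image \<eta> = (\<Union>i\<le>m. curve_image (\<xi> i))"
  proof (rule path_chain[of m X \<xi>])
    show "curve_end (\<xi> i) = curve_start (\<xi> (i + 1))" if "i < m" for i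
      using joined[of i] that m by simp
  qed (use geo m in \<open>auto intro: geodesic_imp_path\<close>)
  have ends: "curve_start \<eta> = curve_end (\<xi> n)" "curve_end \<eta> = curve_start (\<xi> n)"
    using joined[of n] joined[of m] \<eta> m by auto
  show "thin_polygon X \<epsilon> n \<xi>"
    unfolding thin_polygon_def
  proof
    fix z assume z: "z \<in> curve_image (\<xi> n)"
    \<comment> \<open>The last side runs from the end of \<open>\<eta>\<close> to its start, so its
      reverse is the geodesic coterminal with \<open>\<eta>\<close>.\<close>
    with assms obtain w where "w \<in> curve_image \<eta>" "dist z w \<le> \<epsilon>"
      by (rule_tac geodesics_stableD[of X \<epsilon> "curve_reverse (\<xi> n)" \<eta> z])
        (use geodesic_reverse[OF geo[of n]] \<eta> ends in auto)
    then show "z \<in> closed_nbhd X \<epsilon> (\<Union>i<n. curve_image (\<xi> i))"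
      using curve_image_subset[OF geodesic_imp_path[OF geo[of n]]] z \<eta>(4) m
      by (auto simp: mem_closed_nbhd lessThan_Suc_atMost)
  qed
qed

text \<open>Stability, applied to \<open>\<alpha>\<close> followed by \<open>\<beta>\<close>, covers
  the connected image of \<open>\<xi>\<close> by the points near \<open>\<alpha>\<close> and the
  points near \<open>\<beta>\<close>. Both sets are closed and each contains an end of
  \<open>\<xi>\<close>, so they meet on it.\<close>

lemma stable_center:
  assumes "geodesics_stable X \<epsilon>" "geodesic X \<xi>" "path_in_space X \<alpha>" "path_in_space X \<beta>"
    "curve_start \<alpha> = curve_start \<xi>" "curve_end \<alpha> = curve_start \<beta>" "curve_end \<beta> = curve_end \<xi>"
  obtains z u v where "z \<in> curve_image \<xi>" "u \<in> curve_image \<alpha>" "v \<in> curve_image \<beta>"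
    "dist z u < \<epsilon> + 1" "dist z v < \<epsilon> + 1"
proof -
  \<comment> \<open>Measuring nearness by \<open>infdist\<close> makes these sets closed by
    continuity.\<close>
  let ?A = "{z. infdist z (curve_image \<alpha>) \<le> \<epsilon>}" and ?B = "{z. infdist z (curve_image \<beta>) \<le> \<epsilon>}"
  note path = geodesic_imp_path[OF assms(2)]
  have ne: "curve_image \<alpha> \<noteq> {}" "curve_image \<beta> \<noteq> {}"
    using curve_start_in_image assms(3,4) by blast+
  have near: "infdist z (curve_image \<alpha>) \<le> \<epsilon> \<or> infdist z (curve_image \<beta>) \<le> \<epsilon>"
    if z: "z \<in> curve_image \<xi>" for z
  proof -
    have "0 \<le> fst \<alpha>" "0 \<le> fst \<beta>"
      using assms(3,4) by (auto simp: path_in_space_def)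
    then obtain w where "w \<in> curve_image (curve_join \<alpha> \<beta>)" "dist z w \<le> \<epsilon>"
      using geodesics_stableD[OF assms(1,2) path_in_space_join[OF assms(3,4,6)] _ _ z]
      by (metis assms(5-7) curve_end_join curve_start_join)
    then show ?thesis
      unfolding curve_image_join[OF assms(3,4,6)] by (meson Un_iff infdist_le2)
  qed
  \<comment> \<open>Needed for the ends of \<open>\<xi>\<close>, at \<open>infdist\<close> 0 from
    \<open>\<alpha>\<close> and \<open>\<beta>\<close> respectively, to lie in \<open>?A\<close> and
    \<open>?B\<close>.\<close>
  have eps: "0 \<le> \<epsilon>"
    using near[OF curve_start_in_image[OF path]] infdist_nonneg by (meson order_trans)
  have "connected (curve_image \<xi>)"
    unfolding curve_image_def using path
    by (auto simp: path_in_space_def intro!: connected_continuous_image)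
  moreover have "closed ?A" "closed ?B"
    by (auto intro!: closed_Collect_le continuous_intros)
  moreover have "?A \<inter> curve_image \<xi> \<noteq> {}" "?B \<inter> curve_image \<xi> \<noteq> {}"
    using curve_start_in_image[OF path] curve_end_in_image[OF path] eps
      curve_start_in_image[OF assms(3)] curve_end_in_image[OF assms(4)] assms(5,7)
    by (metis (mono_tags, lifting) Int_iff empty_iff infdist_zero mem_Collect_eq)+
  ultimately obtain z where z: "z \<in> curve_image \<xi>" "z \<in> ?A" "z \<in> ?B"
    using near unfolding connected_closed by blast
  \<comment> \<open>The slack 1 makes the bounds strict, so that the infima yield actual
    points.\<close>
  have "infdist z (curve_image \<alpha>) < \<epsilon> + 1" "infdist z (curve_image \<beta>) < \<epsilon> + 1"
    using z by auto
  then obtain u v where "u \<in> curve_image \<alpha>" "dist z u < \<epsilon> + 1" "v \<in> curve_image \<beta>"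
    "dist z v < \<epsilon> + 1"
    using ne by (auto simp: infdist_notempty cINF_less_iff)
  with z(1) show thesis
    using that by blast
qed

section \<open>The inequality for Gromov products\<close>

text \<open>Converse of \<open>gromov_product_le_dist_geodesic\<close> up to a constant: the point
  sought is a center of a geodesic triangle with third vertex \<open>p\<close>.\<close>

lemma stable_dist_geodesic_le_gromov_product:
  assumes "geodesic_space X" "geodesics_stable X \<epsilon>" "geodesic X \<xi>" "p \<in> X"
  obtains z where "z \<in> curve_image \<xi>"
    "dist p z \<le> gromov_product p (curve_start \<xi>) (curve_end \<xi>) + 2 * (\<epsilon> + 1)"
proof -
  let ?x = "curve_start \<xi>" and ?y = "curve_end \<xi>"
  have "?x \<in> X" "?y \<in> X"
    using curve_start_in_image curve_end_in_image curve_image_subset geodesic_imp_path[OF assms(3)]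
    by blast+
  with assms(1,4) obtain \<alpha> \<beta> where
    \<alpha>: "geodesic X \<alpha>" "curve_start \<alpha> = ?x" "curve_end \<alpha> = p" and
    \<beta>: "geodesic X \<beta>" "curve_start \<beta> = p" "curve_end \<beta> = ?y"
    unfolding geodesic_space_def by meson
  obtain z u v where z: "z \<in> curve_image \<xi>" "u \<in> curve_image \<alpha>" "v \<in> curve_image \<beta>"
    "dist z u < \<epsilon> + 1" "dist z v < \<epsilon> + 1"
    using stable_center[OF assms(2,3) geodesic_imp_path[OF \<alpha>(1)] geodesic_imp_path[OF \<beta>(1)]] \<alpha> \<beta>
    by metis
  \<comment> \<open>Going through \<open>u\<close>, \<open>dist p z + dist z ?x\<close> exceeds
    \<open>dist p ?x\<close> by at most \<open>2 * (\<epsilon> + 1)\<close>; likewise for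
    \<open>?y\<close> through \<open>v\<close>. Add both estimates, use that \<open>z\<close> lies
    on the geodesic, and halve.\<close>
  have "dist p z \<le> gromov_product p ?x ?y + 2 * (\<epsilon> + 1)"
    using geodesic_dist_split[OF assms(3) z(1)] geodesic_dist_split[OF \<alpha>(1) z(2)]
      geodesic_dist_split[OF \<beta>(1) z(3)] z(4,5)
      dist_triangle[of p z u] dist_triangle[of p z v] dist_triangle[of z ?x u]
      dist_triangle[of z ?y v]
    by (simp add: \<alpha> \<beta> gromov_product_def dist_commute field_simps)
  with z(1) show thesis
    using that by blast
qed

definition gromov_polygon_ineq :: "'a::metric_space set \<Rightarrow> real \<Rightarrow> bool" where
  "gromov_polygon_ineq X \<delta> \<longleftrightarrow>
     (\<forall>n\<ge>2. \<forall>x :: nat \<Rightarrow> 'a. \<forall>p\<in>X. (\<forall>i\<le>n. x i \<in> X) \<longrightarrow>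
        gromov_product p (x 0) (x n)
          \<ge> Min ((\<lambda>i. gromov_product p (x i) (x (i + 1))) ` {..<n}) - \<delta>)"

text \<open>The distance from \<open>p\<close> to a suitable \<open>z\<close> on a geodesic from
  \<open>x n\<close> to \<open>x 0\<close> exceeds their Gromov product by at most
  \<open>2 * \<delta> + 4\<close>; thinness costs another \<open>\<delta>\<close> to reach a side of
  the chain, whose distance from \<open>p\<close> bounds the Gromov product of its ends.\<close>

lemma polygon_hyperbolic_imp_gromov_polygon_ineq:
  assumes "geodesic_space X" "polygon_delta_hyperbolic X \<delta>"
  shows "gromov_polygon_ineq X (3 * \<delta> + 4)"
  unfolding gromov_polygon_ineq_def
proof (intro allI ballI impI)
  fix n :: nat and x :: "nat \<Rightarrow> 'a" and p
  assume n: "n \<ge> 2" and p: "p \<in> X" and X: "\<forall>i\<le>n. x i \<in> X"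
  obtain \<xi> where \<xi>: "geodesic X \<xi>" "curve_start \<xi> = x n" "curve_end \<xi> = x 0"
    using assms(1) X unfolding geodesic_space_def by (meson le0 order_refl)
  obtain z where z: "z \<in> curve_image \<xi>"
    "dist p z \<le> gromov_product p (x n) (x 0) + 2 * ((\<delta> + 1) + 1)"
    using stable_dist_geodesic_le_gromov_product[OF assms(1)
        polygon_hyperbolic_imp_stable[OF assms] \<xi>(1) p] \<xi>(2,3) by metis
  from assms obtain i \<eta> w where \<eta>: "i < n" "geodesic X \<eta>" "curve_start \<eta> = x i"
    "curve_end \<eta> = x (i + 1)" "w \<in> curve_image \<eta>" "dist z w \<le> \<delta>"
    by (rule polygon_hyperbolic_near_chain[of X \<delta> n x \<xi> z]) (use n X \<xi> z in auto)
  have "Min ((\<lambda>i. gromov_product p (x i) (x (i + 1))) ` {..<n})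
      \<le> gromov_product p (x i) (x (i + 1))"
    using \<eta>(1) by (intro Min_le) auto
  also have "\<dots> \<le> dist p w"
    using gromov_product_le_dist_geodesic[OF \<eta>(2,5)] \<eta>(3,4) by metis
  also have "\<dots> \<le> gromov_product p (x 0) (x n) + (3 * \<delta> + 4)"
    using dist_triangle[of p w z] \<eta>(6) z(2) by (simp add: gromov_product_commute)
  finally show "gromov_product p (x 0) (x n)
      \<ge> Min ((\<lambda>i. gromov_product p (x i) (x (i + 1))) ` {..<n}) - (3 * \<delta> + 4)"
    by simp
qed

text \<open>Choosing the base point \<open>z\<close> on the geodesic makes the Gromov product of its
  ends vanish, so some consecutive pair of the subdivision has product at most
  \<open>\<delta>\<close> at \<open>z\<close>.\<close>

lemma gromov_polygon_ineq_imp_stable: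
  assumes "gromov_polygon_ineq X \<delta>"
  shows "geodesics_stable X (\<delta> + 1)"
proof (rule geodesics_stableI)
  fix \<xi> \<xi>' z
  assume \<xi>: "geodesic X \<xi>" and \<xi>': "path_in_space X \<xi>'"
    and ends: "curve_start \<xi>' = curve_start \<xi>" "curve_end \<xi>' = curve_end \<xi>"
    and z: "z \<in> curve_image \<xi>"
  obtain n :: nat and x where x: "n \<ge> 2" "x 0 = curve_start \<xi>" "x n = curve_end \<xi>"
    "\<And>i. i \<le> n \<Longrightarrow> x i \<in> curve_image \<xi>'" "\<And>i. i < n \<Longrightarrow> dist (x i) (x (i + 1)) \<le> 1"
    using path_subdivision[OF \<xi>'] ends by auto
  let ?G = "(\<lambda>i. gromov_product z (x i) (x (i + 1))) ` {..<n}"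
  have "\<forall>i\<le>n. x i \<in> X" "z \<in> X"
    using x(4) z curve_image_subset[OF \<xi>'] curve_image_subset[OF geodesic_imp_path[OF \<xi>]] by auto
  then have "gromov_product z (x 0) (x n) \<ge> Min ?G - \<delta>"
    using assms x(1) unfolding gromov_polygon_ineq_def by blast
  then have "Min ?G \<le> \<delta>"
    using gromov_product_on_geodesic[OF \<xi> z] x(2,3) by simp
  moreover have "Min ?G \<in> ?G"
    using x(1) by (intro Min_in) (auto simp: lessThan_empty_iff)
  ultimately obtain i where i: "i < n" "gromov_product z (x i) (x (i + 1)) \<le> \<delta>"
    by auto
  \<comment> \<open>The distances from \<open>z\<close> to \<open>x i\<close> and
    \<open>x (i + 1)\<close> differ by at most their mutual distance, hence the product is at least
    \<open>dist z (x i)\<close> minus that distance.\<close>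
  then have "dist z (x i) \<le> \<delta> + 1"
    using x(5)[of i] dist_triangle[of z "x i" "x (i + 1)"]
    by (simp add: gromov_product_def dist_commute)
  then show "\<exists>w\<in>curve_image \<xi>'. dist z w \<le> \<delta> + 1"
    using x(4)[of i] i(1) by auto
qed

section \<open>Mesh\<close>

lemma diameter_triple_le:
  fixes a b c :: "'a::metric_space"
  assumes "dist a b \<le> d" "dist b c \<le> d" "dist a c \<le> d"
  shows "diameter {a, b, c} \<le> d"
proof -
  obtain x y where "x \<in> {a, b, c}" "y \<in> {a, b, c}" "dist x y = diameter {a, b, c}"
    using diameter_compact_attained[OF finite_imp_compact, of "{a, b, c}"]
    by (metis finite.emptyI finite_insert insert_not_empty)
  moreover have "0 \<le> d"
    using assms(1) zero_le_dist order_trans by blast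
  ultimately show ?thesis
    using assms by (auto simp: dist_commute)
qed

lemma dist_le_diameter_triple:
  fixes a b c :: "'a::metric_space"
  assumes "x \<in> {a, b, c}" "y \<in> {a, b, c}"
  shows "dist x y \<le> diameter {a, b, c}"
  using assms by (intro diameter_bounded_bound finite_imp_bounded) auto

lemma triangle_mesh_le:
  assumes "u0 \<in> curve_image (\<xi> 0)" "u1 \<in> curve_image (\<xi> 1)" "u2 \<in> curve_image (\<xi> 2)"
  shows "triangle_mesh \<xi> \<le> diameter {u0, u1, u2}"
  unfolding triangle_mesh_def
  by (rule cInf_lower) (use assms in \<open>auto intro!: bdd_belowI[of _ 0] diameter_ge_0\<close>)

lemma triangle_mesh_less_obtain:
  assumes "path_triangle X \<xi>" "triangle_mesh \<xi> < d"
  obtains u0 u1 u2 where "u0 \<in> curve_image (\<xi> 0)" "u1 \<in> curve_image (\<xi> 1)"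
    "u2 \<in> curve_image (\<xi> 2)" "diameter {u0, u1, u2} < d"
proof -
  \<comment> \<open>The start points show that the infimum is taken over a nonempty set, as
    \<open>cInf_lessD\<close> requires.\<close>
  have "curve_start (\<xi> i) \<in> curve_image (\<xi> i)" if "i \<le> 2" for i
    using assms(1) that curve_start_in_image unfolding path_triangle_def by blast
  from this[of 0] this[of 1] this[of 2] have ne: "{diameter {u0, u1, u2} | u0 u1 u2.
     u0 \<in> curve_image (\<xi> 0) \<and> u1 \<in> curve_image (\<xi> 1) \<and> u2 \<in> curve_image (\<xi> 2)} \<noteq> {}"
    by auto
  from assms(2) show thesis
    unfolding triangle_mesh_def by (rule cInf_lessD[OF ne, THEN bexE]) (use that in auto)
qed

lemma cyclically_joined_2:
  "cyclically_joined 2 \<xi> \<longleftrightarrow> curve_end (\<xi> 0) = curve_start (\<xi> 1) \<and>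
     curve_end (\<xi> 1) = curve_start (\<xi> 2) \<and> curve_end (\<xi> 2) = curve_start (\<xi> 0)"
proof -
  have "i \<le> 2 \<longleftrightarrow> i = 0 \<or> i = 1 \<or> i = 2" for i :: nat
    by linarith
  then show ?thesis
    by (auto simp: cyclically_joined_def numeral_2_eq_2)
qed

text \<open>A geodesic \<open>\<gamma>\<close> between the ends of the third side has a center close
  to the first two sides, and stability puts that center close to the third side as well.\<close>

lemma stable_imp_triangle_mesh_le:
  assumes "geodesic_space X" "geodesics_stable X \<epsilon>" "path_triangle X \<xi>"
  shows "triangle_mesh \<xi> \<le> 2 * (\<epsilon> + 1)"
proof -
  have paths: "path_in_space X (\<xi> 0)" "path_in_space X (\<xi> 1)" "path_in_space X (\<xi> 2)"
    and ends: "curve_end (\<xi> 0) = curve_start (\<xi> 1)" "curve_end (\<xi> 1) = curve_start (\<xi> 2)"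
      "curve_end (\<xi> 2) = curve_start (\<xi> 0)"
    using assms(3) by (auto simp: path_triangle_def cyclically_joined_2)
  have "curve_start (\<xi> 2) \<in> X" "curve_end (\<xi> 2) \<in> X"
    using curve_start_in_image curve_end_in_image curve_image_subset paths(3) by blast+
  with assms(1) obtain \<gamma> where
    \<gamma>: "geodesic X \<gamma>" "curve_start \<gamma> = curve_end (\<xi> 2)" "curve_end \<gamma> = curve_start (\<xi> 2)"
    unfolding geodesic_space_def by meson
  obtain z u v where z: "z \<in> curve_image \<gamma>" "u \<in> curve_image (\<xi> 0)" "v \<in> curve_image (\<xi> 1)"
    "dist z u < \<epsilon> + 1" "dist z v < \<epsilon> + 1"
    using stable_center[OF assms(2) \<gamma>(1) paths(1,2)] ends \<gamma> by metis
  obtain w where w: "w \<in> curve_image (\<xi> 2)" "dist z w \<le> \<epsilon>"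
    using geodesics_stableD[OF assms(2) \<gamma>(1) path_in_space_reverse[OF paths(3)] _ _ z(1)] \<gamma> by auto
  have "dist u v \<le> 2 * (\<epsilon> + 1)" "dist v w \<le> 2 * (\<epsilon> + 1)" "dist u w \<le> 2 * (\<epsilon> + 1)"
    using z(4,5) w(2) dist_triangle3[of u v z] dist_triangle3[of v w z] dist_triangle3[of u w z]
    by argo+
  then have "diameter {u, v, w} \<le> 2 * (\<epsilon> + 1)"
    by (rule diameter_triple_le)
  then show ?thesis
    using triangle_mesh_le[of u \<xi> v w] z w by linarith
qed

text \<open>If \<open>z\<close> lies between \<open>u0\<close> and \<open>u1\<close> on the
  geodesic, then \<open>dist z u0\<close> is at most \<open>dist u0 u1\<close>; a third point
  \<open>u2\<close> on the path near \<open>u0\<close> is then near \<open>z\<close>.\<close>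

lemma triangle_mesh_le_imp_stable:
  assumes "\<And>\<xi>. path_triangle X \<xi> \<Longrightarrow> triangle_mesh \<xi> \<le> M"
  shows "geodesics_stable X (2 * (M + 1))"
proof (rule geodesics_stableI)
  fix \<xi> \<xi>' z
  assume \<xi>: "geodesic X \<xi>" and \<xi>': "path_in_space X \<xi>'"
    and ends: "curve_start \<xi>' = curve_start \<xi>" "curve_end \<xi>' = curve_end \<xi>"
    and "z \<in> curve_image \<xi>"
  then obtain t where t: "0 \<le> t" "t \<le> fst \<xi>" "z = snd \<xi> t"
    by (auto simp: curve_image_def)
  \<comment> \<open>The point \<open>z\<close> cuts \<open>\<xi>\<close> into two sides, and the
    reversed path leads from the end of \<open>\<xi>\<close> back to its start.\<close>
  define T where "T i = (if i = 0 then curve_part \<xi> 0 t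
    else if i = 1 then curve_part \<xi> t (fst \<xi>) else curve_reverse \<xi>')" for i :: nat
  have T: "path_triangle X T"
    unfolding path_triangle_def cyclically_joined_2
    using ends t geodesic_imp_path[OF \<xi>] path_in_space_reverse[OF \<xi>']
    by (auto simp: T_def curve_start_part curve_end_part path_in_space_part)
      (auto simp: curve_start_def curve_end_def)
  \<comment> \<open>A strict bound is needed to extract points from the infimum.\<close>
  have "triangle_mesh T < M + 1"
    using assms[OF T] by simp
  with T obtain u0 u1 u2 where u: "u0 \<in> curve_image (T 0)" "u1 \<in> curve_image (T 1)"
    "u2 \<in> curve_image (T 2)" "diameter {u0, u1, u2} < M + 1"
    by (rule triangle_mesh_less_obtain)
  obtain a b where ab: "0 \<le> a" "a \<le> t" "u0 = snd \<xi> a" "t \<le> b" "b \<le> fst \<xi>" "u1 = snd \<xi> b"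
    using u(1,2) by (auto simp: T_def curve_image_part)
  have "dist z u0 \<le> dist u0 u1"
    using \<xi> ab t by (auto simp: geodesic_def)
  moreover have "dist u0 u1 < M + 1" "dist u0 u2 < M + 1"
    using dist_le_diameter_triple[of u0 u0 u1 u2 u1] dist_le_diameter_triple[of u0 u0 u1 u2 u2] u(4)
    by auto
  ultimately have "dist z u2 \<le> 2 * (M + 1)"
    using dist_triangle[of z u2 u0] by argo
  moreover have "u2 \<in> curve_image \<xi>'"
    using u(3) by (simp add: T_def)
  ultimately show "\<exists>w\<in>curve_image \<xi>'. dist z w \<le> 2 * (M + 1)"
    by blast
qed

lemma space_mesh_finite_iff:
  "space_mesh X < \<infinity> \<longleftrightarrow> (\<exists>M. \<forall>\<xi>. path_triangle X \<xi> \<longrightarrow> triangle_mesh \<xi> \<le> M)"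
proof
  assume "space_mesh X < \<infinity>"
  \<comment> \<open>For empty \<open>X\<close> there are no triangles and the supremum is
    \<open>-\<infinity>\<close>; any real \<open>M\<close> serves in that case.\<close>
  then obtain M :: real where "space_mesh X \<le> ereal M"
    by (cases "space_mesh X") auto
  then show "\<exists>M. \<forall>\<xi>. path_triangle X \<xi> \<longrightarrow> triangle_mesh \<xi> \<le> M"
    unfolding space_mesh_def by (auto simp: SUP_le_iff)
next
  assume "\<exists>M. \<forall>\<xi>. path_triangle X \<xi> \<longrightarrow> triangle_mesh \<xi> \<le> M"
  then obtain M where "\<And>\<xi>. path_triangle X \<xi> \<Longrightarrow> triangle_mesh \<xi> \<le> M"
    by blast
  then have "space_mesh X \<le> ereal M"
    unfolding space_mesh_def by (auto simp: SUP_le_iff)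
  then show "space_mesh X < \<infinity>"
    using le_less_trans less_ereal.simps(4) by blast
qed

section \<open>Equivalence of the four conditions through stability\<close>

theorem theorem3p2:
  fixes X :: "'a::metric_space set"
  assumes "geodesic_space X"
  shows
    "(polygon_hyperbolic X
       \<longleftrightarrow> (\<exists>\<delta>'\<ge>0. \<forall>n\<ge>2. \<forall>x :: nat \<Rightarrow> 'a. \<forall>p\<in>X. (\<forall>i\<le>n. x i \<in> X) \<longrightarrow>
             gromov_product p (x 0) (x n)
               \<ge> Min ((\<lambda>i. gromov_product p (x i) (x (i + 1))) ` {..<n}) - \<delta>'))
   \<and> (polygon_hyperbolic X
       \<longleftrightarrow> (\<exists>\<epsilon>\<ge>0. \<forall>\<xi> \<xi>'. geodesic X \<xi> \<and> path_in_space X \<xi>' \<and> coterminal \<xi>' \<xi> \<longrightarrow>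
             curve_image \<xi> \<subseteq> closed_nbhd X \<epsilon> (curve_image \<xi>')))
   \<and> (polygon_hyperbolic X \<longleftrightarrow> space_mesh X < \<infinity>)"
proof -
  have "polygon_hyperbolic X \<longleftrightarrow> (\<exists>\<epsilon>\<ge>0. geodesics_stable X \<epsilon>)"
    unfolding polygon_hyperbolic_def
    using polygon_hyperbolic_imp_stable[OF assms] stable_imp_polygon_hyperbolic
    by (metis add_increasing2 zero_le_one)
  moreover have "polygon_hyperbolic X \<longleftrightarrow> (\<exists>\<delta>'\<ge>0. gromov_polygon_ineq X \<delta>')"
  proof
    assume "polygon_hyperbolic X"
    then obtain \<delta> where "\<delta> \<ge> 0" "polygon_delta_hyperbolic X \<delta>"
      unfolding polygon_hyperbolic_def by blast
    then show "\<exists>\<delta>'\<ge>0. gromov_polygon_ineq X \<delta>'"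
      using polygon_hyperbolic_imp_gromov_polygon_ineq[OF assms]
      by (intro exI[of _ "3 * \<delta> + 4"]) auto
  next
    \<comment> \<open>The way back passes through (iii): stability with constant
      \<open>\<delta>' + 1\<close>, which is also the thinness constant.\<close>
    assume "\<exists>\<delta>'\<ge>0. gromov_polygon_ineq X \<delta>'"
    then show "polygon_hyperbolic X"
      unfolding polygon_hyperbolic_def
      using stable_imp_polygon_hyperbolic[OF gromov_polygon_ineq_imp_stable]
      by (metis add_increasing2 zero_le_one)
  qed
  moreover have "(\<exists>\<epsilon>\<ge>0. geodesics_stable X \<epsilon>) \<longleftrightarrow> space_mesh X < \<infinity>"
    unfolding space_mesh_finite_iff
  proof
    show "\<exists>M. \<forall>\<xi>. path_triangle X \<xi> \<longrightarrow> triangle_mesh \<xi> \<le> M" if "\<exists>\<epsilon>\<ge>0. geodesics_stable X \<epsilon>"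
      using that stable_imp_triangle_mesh_le[OF assms] by blast
    show "\<exists>\<epsilon>\<ge>0. geodesics_stable X \<epsilon>"
      if "\<exists>M. \<forall>\<xi>. path_triangle X \<xi> \<longrightarrow> triangle_mesh \<xi> \<le> M"
      \<comment> \<open>A bound \<open>M\<close> may be negative when \<open>X\<close> is empty, so
        the constant is enlarged to its maximum with 0.\<close>
      using that triangle_mesh_le_imp_stable geodesics_stable_mono
      by (metis max.cobounded1 max.cobounded2)
  qed
  ultimately show ?thesis
    unfolding geodesics_stable_def gromov_polygon_ineq_def by argo
qed

end
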